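(* Assume that $m$ computing nodes are used in the multigrid scheme for the Gross-Pitaevskii equation, that solving the Gross-Pitaevskii eigenvalue problems in the coarse spaces $V_{H,h_k}$ ($k=1,\dots,n$) and in $V_{h_1}$ needs work $\mathcal{O}(M_H)$ and $\mathcal{O}(M_{h_1})$, respectively, and that the work of the multigrid method for solving the linear source problem in $V_{h_k}$ is $\mathcal{O}(N_k)$ for $k=2,3,\dots,n$. Let $\varpi$ denote the number of nonlinear iterations used when solving the nonlinear eigenvalue problem in $V_{H,h_k}$. Then in each computing node the work involved in the multigrid scheme satisfies $$\text{Total work}=\mathcal{O}\Big(\big(1+\tfrac{\varpi}{m}\big)N_n+M_H\log N_n+M_{h_1}\Big).$$
   Context: Continuous problem and spaces. $\Omega\subset\mathbb{R}^d$ ($d=2,3$) is a bounded computing domain with the cone property, $V=H_0^1(\Omega)$, $\zeta>0$, $W(x)=\gamma_1x_1^2+\dots+\gamma_dx_d^2$ with all $\gamma_i>0$, $$a(u,v)=\int_\Omega\big(\nabla u\cdot\nabla v+Wuv+\zeta|u|^2uv\big)\,d\Omega,\qquad b(u,v)=\int_\Omega uv\,d\Omega .$$ The Gross-Pitaevskii eigenvalue problem in a subspace $X\subset V$ is to find the ground state $(\lambda,w)\in\mathbb{R}\times X$ with $b(w,w)=1$ and $a(w,v)=\lambda b(w,v)$ for all $v\in X$. $V_H$ is the linear finite element space on a coarse mesh $\mathcal{T}_H$ of $\Omega$; $\mathcal{T}_{h_1}$ is produced from $\mathcal{T}_H$ by regular refinement, and $\mathcal{T}_{h_k}$ from $\mathcal{T}_{h_{k-1}}$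 by regular refinement with $h_k\approx\frac1\beta h_{k-1}$, $k=2,\dots,n$, where $\beta$ ($>1$) is the refinement index. The corresponding linear finite element spaces satisfy $V_H\subseteq V_{h_1}\subset V_{h_2}\subset\dots\subset V_{h_n}\subset V$. Put $N_k=\dim V_{h_k}$; then $N_k\approx(1/\beta)^{d(n-k)}N_n$ for $k=1,\dots,n$. Here $\approx$ means equality up to two-sided constant factors independent of the mesh sizes. Multigrid scheme. First solve the Gross-Pitaevskii eigenvalue problem in $V_{h_1}$ to get $(\lambda_{h_1},u_{h_1})$. Then for $k=1,\dots,n-1$ perform one correction step: (1) compute by a multigrid method, to $H^1$-accuracy $\varsigma_{h_{k+1}}$ (up to a constant), an approximation $\widetilde e_{h_{k+1}}\in V_{h_{k+1}}$ to the solution $\widehat e_{h_{k+1}}\in V_{h_{k+1}}$ of the linear source problem $\int_\Omega\nabla\widehat e_{h_{k+1}}\cdot\nabla v\,d\Omega=\lambda_{h_k}b(u_{h_k},v)-a(u_{h_k},v)$ for all $v\in V_{h_{k+1}}$, and set $\widetilde u_{h_{k+1}}=u_{h_k}+\widetilde e_{h_{k+1}}$; (2) set $V_{H,h_{k+1}}=V_H+\mathrm{span}\{\widetilde u_{h_{k+1}}\}$ and solve the nonlinear Gross-Pitaevskii eigenvalue problem in $V_{H,h_{k+1}}$ by a nonlinear iteration (self-consistent or Newton type) to get $(\lambda_{h_{k+1}},u_{h_{k+1}})$. Cost model. In each nonlinear iteration step for the eigenvalue problem in $V_{H,h_k}$ ($k=2,\dots,n$) the matrix on $V_{H,h_k}$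 must be built, which needs work $\mathcal{O}(N_k)$; this matrix building is carried out in parallel without data transfer over the $m$ computing nodes, so it costs $\mathcal{O}(N_k/m)$ per node and per iteration, in addition to the work $\mathcal{O}(M_H)$. The total work is the sum over the initial solve in $V_{h_1}$ and all correction steps, levels $k=2,\dots,n$. *)

theory Defs
  imports
    "HOL-Analysis.Analysis"
    "HOL-Library.Landau_Symbols"
    "HOL-Library.Function_Algebras"
begin

section \<open>Functions as a real vector space\<close>

text \<open>This makes the library's \<open>span\<close>, \<open>dim\<close> and \<open>subspace\<close> available for spaces of functions.\<close>

instantiation "fun" :: (type, real_vector) real_vector
begin

definition scaleR_fun :: "real \<Rightarrow> ('a \<Rightarrow> 'b) \<Rightarrow> 'a \<Rightarrow> 'b"
  where "scaleR_fun c f = (\<lambda>x. c *\<^sub>R f x)"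

instance
  by standard (auto simp: scaleR_fun_def fun_eq_iff scaleR_add_right scaleR_add_left)

end

section \<open>Domains and the space \<open>H\<^sub>0\<^sup>1\<close>\<close>

text \<open>The interior cone property of Adams: every point of \<open>\<Omega>\<close> is the apex of a finite cone inside
  \<open>\<Omega>\<close> congruent to one fixed cone, of height \<open>\<rho>\<close> and aperture angle \<open>\<kappa>\<close>.\<close>

definition cone_property :: "(real^'d) set \<Rightarrow> bool" where
  "cone_property \<Omega> \<longleftrightarrow>
     (\<exists>\<rho> > 0. \<exists>\<kappa>. 0 < \<kappa> \<and> \<kappa> \<le> pi \<and>
        (\<forall>x\<in>\<Omega>. \<exists>\<xi>. norm \<xi> = 1 \<and>
           {x + y | y. norm y \<le> \<rho> \<and> y \<bullet> \<xi> \<ge> norm y * cos (\<kappa> / 2)} \<subseteq> \<Omega>))"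

definition partial_deriv :: "'d \<Rightarrow> (real^'d \<Rightarrow> real) \<Rightarrow> real^'d \<Rightarrow> real" where
  "partial_deriv i f x = frechet_derivative f (at x) (axis i 1)"

primrec Ck :: "nat \<Rightarrow> (real^'d \<Rightarrow> real) \<Rightarrow> bool" where
  "Ck 0 f \<longleftrightarrow> continuous_on UNIV f"
| "Ck (Suc k) f \<longleftrightarrow> (\<forall>x. f differentiable (at x)) \<and> (\<forall>i. Ck k (partial_deriv i f))"

definition test_functions :: "(real^'d) set \<Rightarrow> (real^'d \<Rightarrow> real) set" where
  "test_functions \<Omega> =
     {\<phi>. (\<forall>k. Ck k \<phi>) \<and> compact (closure {x. \<phi> x \<noteq> 0}) \<and> closure {x. \<phi> x \<noteq> 0} \<subseteq> \<Omega>}"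

definition square_integrable :: "(real^'d) set \<Rightarrow> (real^'d \<Rightarrow> 'b::euclidean_space) \<Rightarrow> bool" where
  "square_integrable \<Omega> f \<longleftrightarrow>
     f \<in> borel_measurable (lebesgue_on \<Omega>) \<and> integrable (lebesgue_on \<Omega>) (\<lambda>x. (norm (f x))\<^sup>2)"

definition has_weak_grad :: "(real^'d) set \<Rightarrow> (real^'d \<Rightarrow> real) \<Rightarrow> (real^'d \<Rightarrow> real^'d) \<Rightarrow> bool" where
  "has_weak_grad \<Omega> u g \<longleftrightarrow> square_integrable \<Omega> g \<and>
     (\<forall>\<phi>\<in>test_functions \<Omega>. \<forall>i.
        (LINT x|lebesgue_on \<Omega>. u x * partial_deriv i \<phi> x) = - (LINT x|lebesgue_on \<Omega>. g x $ i * \<phi> x))"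

text \<open>The weak gradient is unique only up to null sets; \<open>weak_grad\<close> picks a representative and
  is used only under integrals over \<open>\<Omega>\<close>.\<close>

definition weak_grad :: "(real^'d) set \<Rightarrow> (real^'d \<Rightarrow> real) \<Rightarrow> real^'d \<Rightarrow> real^'d" where
  "weak_grad \<Omega> u = (SOME g. has_weak_grad \<Omega> u g)"

definition H1 :: "(real^'d) set \<Rightarrow> (real^'d \<Rightarrow> real) set" where
  "H1 \<Omega> = {u. square_integrable \<Omega> u \<and> (\<exists>g. has_weak_grad \<Omega> u g)}"

definition H1_norm :: "(real^'d) set \<Rightarrow> (real^'d \<Rightarrow> real) \<Rightarrow> real" where
  "H1_norm \<Omega> u = sqrt (LINT x|lebesgue_on \<Omega>. (u x)\<^sup>2 + (norm (weak_grad \<Omega> u x))\<^sup>2)"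

definition H10 :: "(real^'d) set \<Rightarrow> (real^'d \<Rightarrow> real) set" where
  "H10 \<Omega> = {u\<in>H1 \<Omega>. \<exists>\<phi>. (\<forall>j. \<phi> j \<in> test_functions \<Omega>) \<and> (\<lambda>j::nat. H1_norm \<Omega> (u - \<phi> j)) \<longlonglongrightarrow> 0}"

section \<open>The Gross-Pitaevskii eigenvalue problem\<close>

definition trap :: "real^'d \<Rightarrow> real^'d \<Rightarrow> real" where
  "trap \<gamma> x = (\<Sum>i\<in>UNIV. \<gamma> $ i * (x $ i)\<^sup>2)"

definition form_a :: "(real^'d) set \<Rightarrow> real^'d \<Rightarrow> real \<Rightarrow> (real^'d \<Rightarrow> real) \<Rightarrow> (real^'d \<Rightarrow> real) \<Rightarrow> real" where
  "form_a \<Omega> \<gamma> \<zeta> u v =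
     (LINT x|lebesgue_on \<Omega>. weak_grad \<Omega> u x \<bullet> weak_grad \<Omega> v x + trap \<gamma> x * u x * v x
                            + \<zeta> * \<bar>u x\<bar>\<^sup>2 * u x * v x)"

definition form_b :: "(real^'d) set \<Rightarrow> (real^'d \<Rightarrow> real) \<Rightarrow> (real^'d \<Rightarrow> real) \<Rightarrow> real" where
  "form_b \<Omega> u v = (LINT x|lebesgue_on \<Omega>. u x * v x)"

definition gp_energy :: "(real^'d) set \<Rightarrow> real^'d \<Rightarrow> real \<Rightarrow> (real^'d \<Rightarrow> real) \<Rightarrow> real" where
  "gp_energy \<Omega> \<gamma> \<zeta> w =
     (LINT x|lebesgue_on \<Omega>. (norm (weak_grad \<Omega> w x))\<^sup>2 + trap \<gamma> x * (w x)\<^sup>2 + \<zeta> / 2 * \<bar>w x\<bar>^4)"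

text \<open>A ground state in \<open>X\<close> is a normalised eigenpair whose eigenfunction has least energy among
  the normalised elements of \<open>X\<close>; \<open>form_a w w\<close> is not the energy, hence \<open>gp_energy\<close>.\<close>

definition gp_ground_state ::
    "(real^'d) set \<Rightarrow> real^'d \<Rightarrow> real \<Rightarrow> (real^'d \<Rightarrow> real) set \<Rightarrow> real \<Rightarrow> (real^'d \<Rightarrow> real) \<Rightarrow> bool" where
  "gp_ground_state \<Omega> \<gamma> \<zeta> X lam w \<longleftrightarrow>
     w \<in> X \<and> form_b \<Omega> w w = 1 \<and>
     (\<forall>v\<in>X. form_a \<Omega> \<gamma> \<zeta> w v = lam * form_b \<Omega> w v) \<and>
     (\<forall>v\<in>X. form_b \<Omega> v v = 1 \<longrightarrow> gp_energy \<Omega> \<gamma> \<zeta> w \<le> gp_energy \<Omega> \<gamma> \<zeta> v)"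

section \<open>Meshes and linear finite element spaces\<close>

definition mesh_of :: "(real^'d) set \<Rightarrow> (real^'d) set set \<Rightarrow> bool" where
  "mesh_of \<Omega> T \<longleftrightarrow> triangulation T \<and> (\<forall>K\<in>T. int CARD('d) simplex K) \<and> \<Union>T = closure \<Omega>"

definition mesh_size :: "(real^'d) set set \<Rightarrow> real" where
  "mesh_size T = Max (diameter ` T)"

definition inradius :: "(real^'d) set \<Rightarrow> real" where
  "inradius K = Sup {\<rho>. \<exists>x. cball x \<rho> \<subseteq> K}"

definition mesh_shape :: "(real^'d) set set \<Rightarrow> real" where
  "mesh_shape T = Max ((\<lambda>K. diameter K / inradius K) ` T)"

definition mesh_refines :: "(real^'d) set set \<Rightarrow> (real^'d) set set \<Rightarrow> bool" where
  "mesh_refines T' T \<longleftrightarrow>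
     (\<forall>K'\<in>T'. \<exists>K\<in>T. K' \<subseteq> K) \<and> (\<forall>K\<in>T. K = \<Union>{K'\<in>T'. K' \<subseteq> K})"

text \<open>Finite element functions are extended by zero outside \<open>\<Omega>\<close>, so that different functions are
  different elements of the space and \<open>dim\<close> is the number of degrees of freedom.\<close>

definition fe_space :: "(real^'d) set \<Rightarrow> (real^'d) set set \<Rightarrow> (real^'d \<Rightarrow> real) set" where
  "fe_space \<Omega> T = {v. continuous_on UNIV v \<and> (\<forall>x. x \<notin> \<Omega> \<longrightarrow> v x = 0) \<and>
                      (\<forall>K\<in>T. \<exists>c g. \<forall>x\<in>K. v x = c + g \<bullet> x)}"

section \<open>The multigrid scheme\<close>

text \<open>One execution of the scheme together with the work it spends.  Level \<open>k\<close> refers to the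
  mesh \<open>r_T r k\<close> with \<open>1 \<le> k \<le> r_n r\<close>, and the correction step producing level \<open>k\<close> from
  level \<open>k - 1\<close> is indexed by \<open>k \<ge> 2\<close>.  \<open>r_MH\<close> and \<open>r_Mh1\<close> are the quantities in terms of which
  the eigenvalue solves are bounded, while the fields ending in \<open>work\<close> are the
  actual work: of the solve in the first space, of the linear source problem on level \<open>k\<close>, of the
  eigenvalue solve in the enriched coarse space of level \<open>k\<close> (all iterations, matrix building
  excluded), and of the matrix building by node \<open>p\<close> in iteration \<open>j\<close> on level \<open>k\<close>.\<close>

record ('d::finite) gp_run =
  r_n :: nat
  r_TH :: "(real^'d) set set"
  r_T :: "nat \<Rightarrow> (real^'d) set set"
  r_lam :: "nat \<Rightarrow> real"
  r_u :: "nat \<Rightarrow> real^'d \<Rightarrow> real"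
  r_ehat :: "nat \<Rightarrow> real^'d \<Rightarrow> real"
  r_etilde :: "nat \<Rightarrow> real^'d \<Rightarrow> real"
  r_accuracy :: "nat \<Rightarrow> real"
  r_nodes :: nat
  r_iterations :: nat
  r_MH :: real
  r_Mh1 :: real
  r_init_work :: real
  r_source_work :: "nat \<Rightarrow> real"
  r_coarse_work :: "nat \<Rightarrow> real"
  r_build_work :: "nat \<Rightarrow> nat \<Rightarrow> nat \<Rightarrow> real"

definition V_H :: "(real^'d) set \<Rightarrow> 'd::finite gp_run \<Rightarrow> (real^'d \<Rightarrow> real) set" where
  "V_H \<Omega> r = fe_space \<Omega> (r_TH r)"

definition V_h :: "(real^'d) set \<Rightarrow> 'd::finite gp_run \<Rightarrow> nat \<Rightarrow> (real^'d \<Rightarrow> real) set" where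
  "V_h \<Omega> r k = fe_space \<Omega> (r_T r k)"

definition N_h :: "(real^'d) set \<Rightarrow> 'd::finite gp_run \<Rightarrow> nat \<Rightarrow> real" where
  "N_h \<Omega> r k = real (dim (V_h \<Omega> r k))"

definition u_tilde :: "'d::finite gp_run \<Rightarrow> nat \<Rightarrow> real^'d \<Rightarrow> real" where
  "u_tilde r k = r_u r (k - 1) + r_etilde r k"

definition V_Hh :: "(real^'d) set \<Rightarrow> 'd::finite gp_run \<Rightarrow> nat \<Rightarrow> (real^'d \<Rightarrow> real) set" where
  "V_Hh \<Omega> r k = {v + w | v w. v \<in> V_H \<Omega> r \<and> w \<in> span {u_tilde r k}}"

definition mesh_hierarchy :: "(real^'d) set \<Rightarrow> 'd::finite gp_run \<Rightarrow> bool" where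
  "mesh_hierarchy \<Omega> r \<longleftrightarrow>
     1 \<le> r_n r \<and>
     mesh_of \<Omega> (r_TH r) \<and> (\<forall>k\<in>{1..r_n r}. mesh_of \<Omega> (r_T r k)) \<and>
     mesh_refines (r_T r 1) (r_TH r) \<and>
     (\<forall>k\<in>{2..r_n r}. mesh_refines (r_T r k) (r_T r (k - 1))) \<and>
     V_H \<Omega> r \<subseteq> V_h \<Omega> r 1 \<and>
     (\<forall>k\<in>{2..r_n r}. V_h \<Omega> r (k - 1) \<subset> V_h \<Omega> r k) \<and>
     V_h \<Omega> r (r_n r) \<subset> H10 \<Omega>"

definition correction_step :: "(real^'d) set \<Rightarrow> real^'d \<Rightarrow> real \<Rightarrow> 'd::finite gp_run \<Rightarrow> nat \<Rightarrow> bool" where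
  "correction_step \<Omega> \<gamma> \<zeta> r k \<longleftrightarrow>
     r_ehat r k \<in> V_h \<Omega> r k \<and>
     (\<forall>v\<in>V_h \<Omega> r k.
        (LINT x|lebesgue_on \<Omega>. weak_grad \<Omega> (r_ehat r k) x \<bullet> weak_grad \<Omega> v x) =
        r_lam r (k - 1) * form_b \<Omega> (r_u r (k - 1)) v - form_a \<Omega> \<gamma> \<zeta> (r_u r (k - 1)) v) \<and>
     r_etilde r k \<in> V_h \<Omega> r k \<and>
     gp_ground_state \<Omega> \<gamma> \<zeta> (V_Hh \<Omega> r k) (r_lam r k) (r_u r k)"

definition multigrid_run :: "(real^'d) set \<Rightarrow> real^'d \<Rightarrow> real \<Rightarrow> 'd::finite gp_run \<Rightarrow> bool" where
  "multigrid_run \<Omega> \<gamma> \<zeta> r \<longleftrightarrow>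
     mesh_hierarchy \<Omega> r \<and>
     gp_ground_state \<Omega> \<gamma> \<zeta> (V_h \<Omega> r 1) (r_lam r 1) (r_u r 1) \<and>
     (\<forall>k\<in>{2..r_n r}. correction_step \<Omega> \<gamma> \<zeta> r k) \<and>
     1 \<le> r_nodes r \<and>
     0 \<le> r_MH r \<and> 0 \<le> r_Mh1 r \<and> 0 \<le> r_init_work r \<and>
     (\<forall>k. 0 \<le> r_source_work r k \<and> 0 \<le> r_coarse_work r k) \<and>
     (\<forall>p k j. 0 \<le> r_build_work r p k j)"

definition total_work :: "'d::finite gp_run \<Rightarrow> nat \<Rightarrow> real" where
  "total_work r p =
     r_init_work r +
     (\<Sum>k=2..r_n r. r_source_work r k + r_coarse_work r k +
                     (\<Sum>j<r_iterations r. r_build_work r p k j))"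

text \<open>For a family \<open>R\<close> of runs, \<open>f \<in> O[levels R](g)\<close> says that \<open>\<bar>f (r, k)\<bar> \<le> c * \<bar>g (r, k)\<bar>\<close> with one
  constant \<open>c\<close> for all runs in \<open>R\<close>, hence for all meshes and numbers of levels, and all
  correction levels \<open>k\<close>; the filter is principal, so nothing is asymptotic in it.\<close>

definition levels :: "'d::finite gp_run set \<Rightarrow> ('d gp_run \<times> nat) filter" where
  "levels R = principal {(r, k). r \<in> R \<and> 2 \<le> k \<and> k \<le> r_n r}"

definition all_levels :: "'d::finite gp_run set \<Rightarrow> ('d gp_run \<times> nat) filter" where
  "all_levels R = principal {(r, k). r \<in> R \<and> 1 \<le> k \<and> k \<le> r_n r}"

definition nodes :: "'d::finite gp_run set \<Rightarrow> ('d gp_run \<times> nat) filter" where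
  "nodes R = principal {(r, p). r \<in> R \<and> p < r_nodes r}"

definition node_iterations :: "'d::finite gp_run set \<Rightarrow> ('d gp_run \<times> nat \<times> nat \<times> nat) filter" where
  "node_iterations R = principal {(r, p, k, j). r \<in> R \<and> p < r_nodes r \<and>
                                    2 \<le> k \<and> k \<le> r_n r \<and> j < r_iterations r}"

text \<open>Refinement is regular if it degrades the shape of the elements at most by a fixed factor,
  whatever the number of refinements.\<close>

definition regular_refinements :: "'d::finite gp_run set \<Rightarrow> bool" where
  "regular_refinements R \<longleftrightarrow>
     (\<lambda>(r, k). mesh_shape (r_T r k)) \<in> O[all_levels R](\<lambda>(r, k). mesh_shape (r_TH r))"

end

theory Submission
  imports Defs
begin

text \<open>An element of \<open>V_h\<close> is determined by its values at the finitely many vertices of the mesh, so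
  the spaces are finite-dimensional; as they increase strictly and the first one contains a
  normalised function, \<open>N_k \<ge> k\<close>. The work on the levels is then a geometric sum dominated by
  \<open>N_n\<close>. The bound \<open>1 \<le> N_1 \<le> C \<beta>\<^bsup>-d(n-1)\<^esup> N_n\<close> makes the number of corrections at most
  a multiple of \<open>ln N_n\<close>; here \<open>N_n \<ge> 2\<close> as soon as there is a correction, so \<open>ln C\<close> is absorbed
  into \<open>ln N_n\<close>.\<close>

section \<open>Dimension of the finite element spaces\<close>

lemma fe_spaceI:
  assumes "continuous_on UNIV v" "\<And>x. x \<notin> \<Omega> \<Longrightarrow> v x = 0"
    and "\<And>K. K \<in> T \<Longrightarrow> \<exists>c g. \<forall>x\<in>K. v x = c + g \<bullet> x"
  shows "v \<in> fe_space \<Omega> T"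
  unfolding fe_space_def mem_Collect_eq by (intro conjI allI impI ballI assms)

lemma fe_space_affineE:
  assumes "v \<in> fe_space \<Omega> T" "K \<in> T"
  obtains c g where "\<And>x. x \<in> K \<Longrightarrow> v x = c + g \<bullet> x"
proof -
  have "\<exists>c g. \<forall>x\<in>K. v x = c + g \<bullet> x"
    using assms unfolding fe_space_def mem_Collect_eq by (elim conjE bspec)
  then show ?thesis using that by (elim exE) blast
qed

lemma subspace_fe_space: "subspace (fe_space \<Omega> T)"
  unfolding subspace_def
proof (intro conjI ballI allI)
  show "0 \<in> fe_space \<Omega> T"
    unfolding fe_space_def by (auto intro!: exI[of _ 0])
next
  fix u v assume uv: "u \<in> fe_space \<Omega> T" "v \<in> fe_space \<Omega> T"
  show "u + v \<in> fe_space \<Omega> T"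
  proof (rule fe_spaceI)
    have "continuous_on UNIV u" "continuous_on UNIV v" using uv by (simp_all add: fe_space_def)
    then show "continuous_on UNIV (u + v)"
      unfolding plus_fun_def by (rule continuous_on_add)
    show "(u + v) x = 0" if "x \<notin> \<Omega>" for x
      using uv that by (simp add: fe_space_def)
    fix K assume "K \<in> T"
    obtain c1 g1 where u: "\<And>x. x \<in> K \<Longrightarrow> u x = c1 + g1 \<bullet> x"
      using fe_space_affineE[OF uv(1) \<open>K \<in> T\<close>] by blast
    obtain c2 g2 where v: "\<And>x. x \<in> K \<Longrightarrow> v x = c2 + g2 \<bullet> x"
      using fe_space_affineE[OF uv(2) \<open>K \<in> T\<close>] by blast
    have "\<forall>x\<in>K. (u + v) x = (c1 + c2) + (g1 + g2) \<bullet> x"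
      using u v by (simp add: inner_add_left)
    then show "\<exists>c g. \<forall>x\<in>K. (u + v) x = c + g \<bullet> x" by (intro exI)
  qed
next
  fix a :: real and v assume v: "v \<in> fe_space \<Omega> T"
  show "a *\<^sub>R v \<in> fe_space \<Omega> T"
  proof (rule fe_spaceI)
    have "continuous_on UNIV v" using v by (simp add: fe_space_def)
    then show "continuous_on UNIV (a *\<^sub>R v)"
      unfolding scaleR_fun_def by (rule continuous_on_scaleR[OF continuous_on_const])
    show "(a *\<^sub>R v) x = 0" if "x \<notin> \<Omega>" for x
      using v that by (simp add: fe_space_def scaleR_fun_def)
    fix K assume "K \<in> T"
    obtain c g where "\<And>x. x \<in> K \<Longrightarrow> v x = c + g \<bullet> x"
      using fe_space_affineE[OF v \<open>K \<in> T\<close>] by blast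
    then have "\<forall>x\<in>K. (a *\<^sub>R v) x = a * c + (a *\<^sub>R g) \<bullet> x"
      by (simp add: scaleR_fun_def algebra_simps)
    then show "\<exists>c g. \<forall>x\<in>K. (a *\<^sub>R v) x = c + g \<bullet> x" by (intro exI)
  qed
qed

section \<open>Finite-dimensionality through vertex values\<close>

text \<open>The zero set of an affine function is convex, so it contains
  \<open>convex hull C\<close> as soon as it contains \<open>C\<close>. Since \<open>f\<close> need
  not be affine off the hull, the argument runs through a level set of the linear functional given
  by \<open>g\<close>.\<close>

lemma affine_zero_on_convex_hull:
  fixes f :: "'a::real_inner \<Rightarrow> real"
  assumes "\<And>x. x \<in> convex hull C \<Longrightarrow> f x = c + g \<bullet> x"
    and "\<And>x. x \<in> C \<Longrightarrow> f x = 0" and "x \<in> convex hull C"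
  shows "f x = 0"
proof -
  have "convex {y. g \<bullet> y = - c}" by (rule convex_hyperplane)
  moreover have "C \<subseteq> {y. g \<bullet> y = - c}"
    using assms(1,2) hull_inc[of _ C convex] by fastforce
  ultimately have "x \<in> {y. g \<bullet> y = - c}" using assms(3) hull_minimal by blast
  then show ?thesis using assms(1,3) by simp
qed

text \<open>All vertices of all simplices serve as \<open>P\<close>: zero vertex values make an
  affine function zero on its simplex, the simplices cover \<open>\<Omega>\<close>, and off
  \<open>\<Omega>\<close> the extension by zero takes over.\<close>

lemma finite_vertices_determine_fe_space:
  assumes "mesh_of \<Omega> T"
  obtains P where "finite P"
    "\<And>v. v \<in> fe_space \<Omega> T \<Longrightarrow> (\<And>x. x \<in> P \<Longrightarrow> v x = 0) \<Longrightarrow> v = 0"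
proof -
  have fin: "finite T" and simp: "\<And>K. K \<in> T \<Longrightarrow> int CARD('a) simplex K" and cov: "\<Union>T = closure \<Omega>"
    using assms unfolding mesh_of_def triangulation_def by auto
  have "\<exists>C. finite C \<and> K = convex hull C" if "K \<in> T" for K
    using simp[OF that] unfolding simplex by blast
  then obtain C where C: "\<And>K. K \<in> T \<Longrightarrow> finite (C K) \<and> K = convex hull (C K)" by metis
  show ?thesis
  proof (rule that)
    show "finite (\<Union>(C ` T))" using fin C by auto
  next
    fix v assume v: "v \<in> fe_space \<Omega> T" and zero: "\<And>x. x \<in> \<Union>(C ` T) \<Longrightarrow> v x = 0"
    have "v x = 0" for x
    proof (cases "x \<in> \<Omega>")
      case True
      then obtain K where K: "K \<in> T" "x \<in> K" using cov closure_subset by blast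
      then obtain c g where "\<forall>x\<in>K. v x = c + g \<bullet> x" using v unfolding fe_space_def by blast
      then show ?thesis
        using affine_zero_on_convex_hull[of "C K" v c g x] C[OF K(1)] K zero by blast
    next
      case False
      then show ?thesis using v unfolding fe_space_def by blast
    qed
    then show "v = 0" by auto
  qed
qed

text \<open>Restriction to the vertices embeds the span of \<open>B\<close> linearly into the
  functions supported on a finite set. This makes \<open>dim\<close> a genuine count, as
  \<open>card\<close> would be 0 on an infinite basis.\<close>

lemma independent_fe_space_finite:
  assumes "mesh_of \<Omega> T" "independent B" "B \<subseteq> fe_space \<Omega> T"
  shows "finite B"
proof -
  obtain P where P: "finite P"
    and det: "\<And>v. v \<in> fe_space \<Omega> T \<Longrightarrow> (\<And>x. x \<in> P \<Longrightarrow> v x = 0) \<Longrightarrow> v = 0"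
    by (rule finite_vertices_determine_fe_space[OF assms(1)]) blast
  \<comment> \<open>Restriction to \<open>P\<close>, extended by zero so that its values are
    functions on the whole space; the point indicators in \<open>E\<close> span a space containing
    its range.\<close>
  define f where "f = (\<lambda>(v :: real^'a \<Rightarrow> real) x. if x \<in> P then v x else 0)"
  define E where "E = (\<lambda>p x. if x = p then 1 else 0 :: real) ` P"
  have lin: "linear f"
    by (rule linearI) (auto simp: f_def scaleR_fun_def)
  \<comment> \<open>Vertex values determine only finite element functions, so injectivity on the
    span needs the span to stay inside the space.\<close>
  have spanB: "span B \<subseteq> fe_space \<Omega> T"
    using assms(3) subspace_fe_space by (rule span_minimal)
  have "inj_on f (span B)"
    unfolding linear_injective_on_subspace_0[OF lin subspace_span]
  proof (intro ballI impI)
    fix v assume "v \<in> span B" "f v = 0"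
    moreover from this(2) have "v x = 0" if "x \<in> P" for x
      using that by (auto simp: f_def dest: fun_cong[of _ _ x])
    ultimately show "v = 0" using spanB det by blast
  qed
  then have ind: "independent (f ` B)"
    using lin assms(2) by (simp add: linear_independent_injective_image)
  have "f v \<in> span E" for v
  proof -
    have "(\<Sum>p\<in>P. v p *\<^sub>R (\<lambda>x. if x = p then 1 else 0 :: real)) y = f v y" for y
    proof -
      \<comment> \<open>Induction on the index set moves the evaluation at \<open>y\<close> inside
        the sum of functions; only the term \<open>p = y\<close> can then survive.\<close>
      have "(\<Sum>p\<in>Q. v p *\<^sub>R (\<lambda>x. if x = p then 1 else 0 :: real)) y
          = (\<Sum>p\<in>Q. if y = p then v p else 0)" if "finite Q" for Q
        using that by (induction Q) (auto simp: scaleR_fun_def)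
      from this[OF P] show ?thesis using P by (simp add: f_def)
    qed
    then have "f v = (\<Sum>p\<in>P. v p *\<^sub>R (\<lambda>x. if x = p then 1 else 0))" by auto
    also have "\<dots> \<in> span E"
      by (intro span_sum span_scale span_base) (auto simp: E_def)
    finally show ?thesis .
  qed
  moreover have "finite E" using P by (simp add: E_def)
  ultimately have "finite (f ` B)"
    using ind independent_span_bound[of E "f ` B"] by blast
  moreover have "inj_on f B"
    using \<open>inj_on f (span B)\<close> span_superset by (rule inj_on_subset)
  ultimately show ?thesis by (simp add: finite_image_iff)
qed

section \<open>Growth of the dimension along the hierarchy\<close>

text \<open>A basis of \<open>U\<close> stays independent when a point of \<open>V\<close> outside
  \<open>U\<close> is added, because the subspace \<open>U\<close> contains its span. Finiteness
  rules out infinite independent sets, whose \<open>card\<close> is 0.\<close>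

lemma dim_psubset_finite:
  fixes U V :: "'a::real_vector set"
  assumes "subspace U" "U \<subset> V"
    and fin: "\<And>B. independent B \<Longrightarrow> B \<subseteq> V \<Longrightarrow> finite B"
  shows "dim U < dim V"
proof -
  obtain B where B: "B \<subseteq> U" "independent B" "U \<subseteq> span B" "card B = dim U"
    using basis_exists by blast
  obtain A where A: "A \<subseteq> V" "independent A" "V \<subseteq> span A" "card A = dim V"
    using basis_exists by blast
  obtain x where x: "x \<in> V" "x \<notin> U" using assms(2) by blast
  have xB: "x \<notin> span B" using x(2) span_minimal[OF B(1) assms(1)] by blast
  then have "independent (insert x B)" using B(2) by (simp add: independent_insert)
  moreover have "insert x B \<subseteq> V" using x B(1) assms(2) by blast
  ultimately have "card (insert x B) \<le> card A" "finite (insert x B)"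
    using A fin independent_span_bound[of A "insert x B"] by auto
  moreover have "x \<notin> B" using xB span_base by blast
  ultimately show ?thesis using A(4) B(4) by simp
qed

text \<open>Each strict inclusion raises the integer dimension by at least one. Level 1 gives a
  nontrivial first space, and the top level compares the number of levels with the finest dimension;
  the logarithm bound uses both.\<close>

lemma N_h_ge:
  assumes run: "multigrid_run \<Omega> \<gamma> \<zeta> r" and "1 \<le> k" "k \<le> r_n r"
  shows "real k \<le> N_h \<Omega> r k"
proof -
  have hier: "mesh_hierarchy \<Omega> r" and gs: "gp_ground_state \<Omega> \<gamma> \<zeta> (V_h \<Omega> r 1) (r_lam r 1) (r_u r 1)"
    using run unfolding multigrid_run_def by auto
  have less: "dim U < dim (V_h \<Omega> r j)"
    if "subspace U" "U \<subset> V_h \<Omega> r j" "1 \<le> j" "j \<le> r_n r" for U j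
  proof (rule dim_psubset_finite[OF that(1,2)])
    have "mesh_of \<Omega> (r_T r j)" using hier that unfolding mesh_hierarchy_def by auto
    then show "finite B" if "independent B" "B \<subseteq> V_h \<Omega> r j" for B
      using independent_fe_space_finite that unfolding V_h_def by blast
  qed
  have "k \<le> dim (V_h \<Omega> r k)"
    using assms(2,3)
  proof (induction k rule: dec_induct)
    case base
    \<comment> \<open>\<open>form_b\<close> vanishes at the zero function, so the normalisation
      makes the first eigenfunction nonzero.\<close>
    have "r_u r 1 \<in> V_h \<Omega> r 1" "r_u r 1 \<noteq> 0"
      using gs unfolding gp_ground_state_def form_b_def by auto
    moreover have "0 \<in> V_h \<Omega> r 1"
      unfolding V_h_def by (rule subspace_0[OF subspace_fe_space])
    ultimately have "{0} \<subset> V_h \<Omega> r 1" by blast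
    then show ?case using less[of "{0}" 1] base by (simp add: subspace_single_0)
  next
    case (step j)
    have "Suc j \<in> {2..r_n r}" using step by auto
    then have "V_h \<Omega> r j \<subset> V_h \<Omega> r (Suc j)"
      using hier unfolding mesh_hierarchy_def by (metis diff_Suc_1)
    then have "dim (V_h \<Omega> r j) < dim (V_h \<Omega> r (Suc j))"
      using less[of "V_h \<Omega> r j" "Suc j"] step subspace_fe_space unfolding V_h_def by fastforce
    then show ?case using step by linarith
  qed
  then show ?thesis unfolding N_h_def by simp
qed

text \<open>For a principal filter "eventually" means at every point of \<open>S\<close>, so a
  single constant serves all runs, levels and nodes collected in \<open>S\<close>.\<close>

lemma bigo_principalE:
  fixes f g :: "'a \<Rightarrow> real"
  assumes "f \<in> O[principal S](g)"
  obtains c where "c > 0" "\<And>x. x \<in> S \<Longrightarrow> \<bar>f x\<bar> \<le> c * \<bar>g x\<bar>"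
proof -
  obtain c where "c > 0" "\<forall>\<^sub>F x in principal S. norm (f x) \<le> c * norm (g x)"
    using assms by (rule landau_o.bigE)
  then show ?thesis using that by (auto simp: eventually_principal)
qed

section \<open>Summation over the levels\<close>

text \<open>Read from \<open>k = n\<close> downwards, the summands are the first terms of a
  geometric series; the missing terms are nonnegative.\<close>

lemma sum_power_diff_le:
  fixes q :: real
  assumes "0 \<le> q" "q < 1"
  shows "(\<Sum>k=2..n. q ^ (n - k)) \<le> 1 / (1 - q)"
proof -
  have "(\<Sum>k=2..n. q ^ (n - k)) \<le> (\<Sum>k=0..n. q ^ (n - k))"
    using assms by (intro sum_mono2) auto
  also have "\<dots> = (\<Sum>k\<le>n. q ^ k)"
    using sum.nat_diff_reindex[of "\<lambda>k. q ^ k" "Suc n"]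
    by (simp add: lessThan_Suc_atMost atLeast0AtMost)
  also have "\<dots> \<le> 1 / (1 - q)"
    using assms by (simp add: sum_gp0 divide_right_mono)
  finally show ?thesis .
qed

text \<open>Taking logarithms in the last assumption gives
  \<open>(n - 1) * ln (1 / q) \<le> ln C + ln N\<close>. Dividing by \<open>ln 2\<close> in the
  constant is what turns \<open>ln C\<close> into a multiple of \<open>ln N\<close>.\<close>

lemma levels_le_ln:
  fixes q C N :: real
  assumes "0 < q" "q < 1" "1 \<le> C" "real n \<le> N" "1 \<le> n" "1 \<le> C * (q ^ (n - 1) * N)"
  shows "real (n - 1) \<le> (ln C / ln 2 + 1) / ln (1 / q) * ln N"
proof (cases "n = 1")
  case True
  then show ?thesis using assms by (simp add: divide_nonneg_pos)
next
  case False
  \<comment> \<open>At least two levels force \<open>N \<ge> 2\<close>, so \<open>ln N\<close> is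
    bounded away from 0; with one level the left-hand side is 0 instead.\<close>
  then have N: "2 \<le> N" using assms by linarith
  have "0 \<le> ln (C * (q ^ (n - 1) * N))" using assms(6) by simp
  also have "\<dots> = ln C + real (n - 1) * ln q + ln N"
    using assms N by (simp add: ln_mult ln_realpow)
  finally have "real (n - 1) * ln (1 / q) \<le> ln C + ln N"
    using assms by (simp add: ln_div)
  \<comment> \<open>\<open>1 \<le> C\<close> makes \<open>ln C\<close> nonnegative, which permits
    multiplying \<open>ln 2 \<le> ln N\<close> by it.\<close>
  also have "ln C * ln 2 \<le> ln C * ln N"
    using assms N by (intro mult_left_mono) auto
  then have "ln C + ln N \<le> (ln C / ln 2 + 1) * ln N"
    by (simp add: field_simps)
  finally show ?thesis
    using assms by (simp add: pos_le_divide_eq)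
qed

text \<open>The bounds are added level by level: source solves and matrix building scale with
  \<open>N k\<close>, the latter once per iteration, while the coarse bound is the same on every
  correction level and is therefore multiplied by their number.\<close>

lemma total_work_le:
  assumes "r_init_work r \<le> ci * r_Mh1 r"
    and "\<And>k. 2 \<le> k \<Longrightarrow> k \<le> r_n r \<Longrightarrow> r_source_work r k \<le> cs * N k"
    and "\<And>k. 2 \<le> k \<Longrightarrow> k \<le> r_n r \<Longrightarrow> r_coarse_work r k \<le> cc * r_MH r"
    and "\<And>k j. 2 \<le> k \<Longrightarrow> k \<le> r_n r \<Longrightarrow> j < r_iterations r \<Longrightarrow> r_build_work r p k j \<le> cb * (N k / m)"
  shows "total_work r p \<le> ci * r_Mh1 r + (cs + cb * (real (r_iterations r) / m)) * (\<Sum>k=2..r_n r. N k)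
           + cc * r_MH r * real (r_n r - 1)"
proof -
  have "r_source_work r k + r_coarse_work r k + (\<Sum>j<r_iterations r. r_build_work r p k j)
      \<le> (cs + cb * (real (r_iterations r) / m)) * N k + cc * r_MH r" if "k \<in> {2..r_n r}" for k
  proof -
    have "(\<Sum>j<r_iterations r. r_build_work r p k j) \<le> (\<Sum>j<r_iterations r. cb * (N k / m))"
      using that assms(4) by (intro sum_mono) auto
    then show ?thesis using assms(2,3)[of k] that by (simp add: algebra_simps)
  qed
  then have "(\<Sum>k=2..r_n r. r_source_work r k + r_coarse_work r k + (\<Sum>j<r_iterations r. r_build_work r p k j))
      \<le> (\<Sum>k=2..r_n r. (cs + cb * (real (r_iterations r) / m)) * N k + cc * r_MH r)"
    by (rule sum_mono)
  also have "\<dots> = (cs + cb * (real (r_iterations r) / m)) * (\<Sum>k=2..r_n r. N k)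
      + cc * r_MH r * real (r_n r - 1)"
    by (simp add: sum.distrib sum_distrib_left)
  finally show ?thesis using assms(1) unfolding total_work_def by linarith
qed

section \<open>One constant for all runs and nodes\<close>

theorem theorem5p1:
  fixes \<Omega> :: "(real^'d) set" and \<gamma> :: "real^'d" and \<zeta> \<beta> :: real
    and R :: "'d gp_run set"
  assumes "CARD('d) = 2 \<or> CARD('d) = 3"
    and "open \<Omega>" and "connected \<Omega>" and "\<Omega> \<noteq> {}" and "bounded \<Omega>" and "cone_property \<Omega>"
    and "\<forall>i. \<gamma> $ i > 0" and "\<zeta> > 0" and "\<beta> > 1"
    and runs: "\<forall>r\<in>R. multigrid_run \<Omega> \<gamma> \<zeta> r"
    and regular: "regular_refinements R"
    and mesh_sizes: "(\<lambda>(r, k). mesh_size (r_T r k))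
           \<in> \<Theta>[levels R](\<lambda>(r, k). 1 / \<beta> * mesh_size (r_T r (k - 1)))"
    and dimensions: "(\<lambda>(r, k). N_h \<Omega> r k)
           \<in> \<Theta>[all_levels R](\<lambda>(r, k). (1 / \<beta>) ^ (CARD('d) * (r_n r - k)) * N_h \<Omega> r (r_n r))"
    and accuracy: "(\<lambda>(r, k). H1_norm \<Omega> (r_etilde r k - r_ehat r k))
           \<in> O[levels R](\<lambda>(r, k). r_accuracy r k)"
    and init_work: "(\<lambda>r. r_init_work r) \<in> O[principal R](\<lambda>r. r_Mh1 r)"
    and coarse_work: "(\<lambda>(r, k). r_coarse_work r k) \<in> O[levels R](\<lambda>(r, k). r_MH r)"
    and source_work: "(\<lambda>(r, k). r_source_work r k) \<in> O[levels R](\<lambda>(r, k). N_h \<Omega> r k)"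
    and build_work: "(\<lambda>(r, p, k, j). r_build_work r p k j)
           \<in> O[node_iterations R](\<lambda>(r, p, k, j). N_h \<Omega> r k / real (r_nodes r))"
  shows "(\<lambda>(r, p). total_work r p)
           \<in> O[nodes R](\<lambda>(r, p). (1 + real (r_iterations r) / real (r_nodes r)) * N_h \<Omega> r (r_n r)
                                 + r_MH r * ln (N_h \<Omega> r (r_n r)) + r_Mh1 r)"
proof -
  \<comment> \<open>The factor per level, up to constants, by which the dimension shrinks towards
    the coarse meshes; \<open>\<beta> > 1\<close> makes the geometric series converge.\<close>
  define q where "q = (1 / \<beta>) ^ CARD('d)"
  have q: "0 < q" "q < 1"
    using \<open>\<beta> > 1\<close> by (auto simp: q_def intro!: power_less_one_iff[THEN iffD2])
  obtain C where C: "C > 0" and C_all: "\<And>x. x \<in> {(r, k). r \<in> R \<and> 1 \<le> k \<and> k \<le> r_n r} \<Longrightarrow>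
      \<bar>case x of (r, k) \<Rightarrow> N_h \<Omega> r k\<bar>
      \<le> C * \<bar>case x of (r, k) \<Rightarrow> (1 / \<beta>) ^ (CARD('d) * (r_n r - k)) * N_h \<Omega> r (r_n r)\<bar>"
    by (rule bigo_principalE[OF bigthetaD1[OF dimensions[unfolded all_levels_def]]]) blast
  have dims: "\<bar>N_h \<Omega> r k\<bar> \<le> C * \<bar>q ^ (r_n r - k) * N_h \<Omega> r (r_n r)\<bar>"
    if "r \<in> R" "1 \<le> k" "k \<le> r_n r" for r k
  proof -
    have "(1 / \<beta>) ^ (CARD('d) * (r_n r - k)) = q ^ (r_n r - k)"
      unfolding q_def by (rule power_mult)
    then show ?thesis using C_all[of "(r, k)"] that by (simp only: prod.case mem_Collect_eq simp_thms)
  qed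
  obtain ci where ci: "ci > 0" "\<And>r. r \<in> R \<Longrightarrow> \<bar>r_init_work r\<bar> \<le> ci * \<bar>r_Mh1 r\<bar>"
    by (rule bigo_principalE[OF init_work]) blast
  obtain cc where cc: "cc > 0" and cc_all: "\<And>x. x \<in> {(r, k). r \<in> R \<and> 2 \<le> k \<and> k \<le> r_n r} \<Longrightarrow>
      \<bar>case x of (r, k) \<Rightarrow> r_coarse_work r k\<bar> \<le> cc * \<bar>case x of (r, k) \<Rightarrow> r_MH r\<bar>"
    by (rule bigo_principalE[OF coarse_work[unfolded levels_def]]) blast
  obtain cs where cs: "cs > 0" and cs_all: "\<And>x. x \<in> {(r, k). r \<in> R \<and> 2 \<le> k \<and> k \<le> r_n r} \<Longrightarrow>
      \<bar>case x of (r, k) \<Rightarrow> r_source_work r k\<bar> \<le> cs * \<bar>case x of (r, k) \<Rightarrow> N_h \<Omega> r k\<bar>"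
    by (rule bigo_principalE[OF source_work[unfolded levels_def]]) blast
  obtain cb where cb: "cb > 0" and cb_all: "\<And>x. x \<in> {(r, p, k, j). r \<in> R \<and> p < r_nodes r \<and>
        2 \<le> k \<and> k \<le> r_n r \<and> j < r_iterations r} \<Longrightarrow>
      \<bar>case x of (r, p, k, j) \<Rightarrow> r_build_work r p k j\<bar>
      \<le> cb * \<bar>case x of (r, p, k, j) \<Rightarrow> N_h \<Omega> r k / real (r_nodes r)\<bar>"
    by (rule bigo_principalE[OF build_work[unfolded node_iterations_def]]) blast
  \<comment> \<open>\<open>C\<close> is only known to be positive, whereas
    \<open>levels_le_ln\<close> asks for a constant of at least 1; hence \<open>max C 1\<close>.
    \<open>D\<close> is the constant for the sum of the dimensions.\<close>
  define L where "L = (ln (max C 1) / ln 2 + 1) / ln (1 / q)"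
  define D where "D = C / (1 - q)"
  have L: "0 \<le> L" using q unfolding L_def by (intro divide_nonneg_pos add_nonneg_nonneg) auto
  have D: "0 \<le> D" using q C unfolding D_def by simp
  \<comment> \<open>One summand for each of the three terms of the bound, so \<open>K\<close>
    dominates every coefficient. It is built from \<open>q\<close> and the Landau constants alone,
    hence independent of \<open>r\<close> and \<open>p\<close>.\<close>
  define K where "K = ci + (cs + cb) * D + cc * L"
  have bound: "\<bar>total_work r p\<bar> \<le> K * \<bar>(1 + real (r_iterations r) / real (r_nodes r)) * N_h \<Omega> r (r_n r)
      + r_MH r * ln (N_h \<Omega> r (r_n r)) + r_Mh1 r\<bar>" if r: "r \<in> R" and p: "p < r_nodes r" for r p
  proof -
    let ?N = "N_h \<Omega> r (r_n r)" and ?t = "real (r_iterations r) / real (r_nodes r)"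
    have run: "multigrid_run \<Omega> \<gamma> \<zeta> r" using runs r by blast
    then have n: "1 \<le> r_n r" and MH: "0 \<le> r_MH r" and Mh1: "0 \<le> r_Mh1 r"
      and nonneg: "0 \<le> r_init_work r" "\<And>k. 0 \<le> r_source_work r k" "\<And>k. 0 \<le> r_coarse_work r k"
        "\<And>k j. 0 \<le> r_build_work r p k j"
      unfolding multigrid_run_def mesh_hierarchy_def by auto
    have N: "real (r_n r) \<le> ?N" using N_h_ge[OF run n] by simp
    then have N1: "1 \<le> ?N" using n by linarith
    have Npos: "0 \<le> N_h \<Omega> r k" for k by (simp add: N_h_def)
    have dim: "N_h \<Omega> r k \<le> C * (q ^ (r_n r - k) * ?N)" if "1 \<le> k" "k \<le> r_n r" for k
      using dims[OF r that] q N1 Npos[of k] by (simp add: abs_mult)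
    have "(\<Sum>k=2..r_n r. N_h \<Omega> r k) \<le> (\<Sum>k=2..r_n r. C * ?N * q ^ (r_n r - k))"
      using dim by (intro sum_mono) (auto simp: mult_ac)
    also have "\<dots> = C * ?N * (\<Sum>k=2..r_n r. q ^ (r_n r - k))" by (simp add: sum_distrib_left)
    also have "\<dots> \<le> C * ?N * (1 / (1 - q))"
      using sum_power_diff_le[of q "r_n r"] q C N1 by (intro mult_left_mono) auto
    finally have sumN: "(\<Sum>k=2..r_n r. N_h \<Omega> r k) \<le> D * ?N" by (simp add: D_def)
    \<comment> \<open>The dimension estimate at level 1, read backwards: a nontrivial first space
      keeps \<open>q ^ (r_n r - 1)\<close> from being too small against \<open>?N\<close>, which
      limits the number of levels.\<close>
    have "1 \<le> C * (q ^ (r_n r - 1) * ?N)"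
      using dim[of 1] N_h_ge[OF run _ n] n by simp
    also have "\<dots> \<le> max C 1 * (q ^ (r_n r - 1) * ?N)"
      using q N1 by (intro mult_right_mono) auto
    finally have lev: "real (r_n r - 1) \<le> L * ln ?N"
      unfolding L_def using q N n by (intro levels_le_ln) auto
    have t: "0 \<le> ?t" by simp
    have "total_work r p \<le> ci * r_Mh1 r + (cs + cb * ?t) * (\<Sum>k=2..r_n r. N_h \<Omega> r k)
        + cc * r_MH r * real (r_n r - 1)"
    proof (rule total_work_le)
      show "r_init_work r \<le> ci * r_Mh1 r" using ci(2)[OF r] Mh1 by simp
      fix k assume k: "2 \<le> k" "k \<le> r_n r"
      show "r_source_work r k \<le> cs * N_h \<Omega> r k"
        using cs_all[of "(r, k)"] r k Npos[of k] by simp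
      show "r_coarse_work r k \<le> cc * r_MH r"
        using cc_all[of "(r, k)"] r k MH by simp
      show "r_build_work r p k j \<le> cb * (N_h \<Omega> r k / real (r_nodes r))" if "j < r_iterations r" for j
        using cb_all[of "(r, p, k, j)"] r p k that Npos[of k] by simp
    qed
    also have "\<dots> \<le> ci * r_Mh1 r + (cs + cb * ?t) * (D * ?N) + cc * r_MH r * (L * ln ?N)"
      using sumN lev cs cb cc MH t
      by (intro add_mono mult_left_mono add_nonneg_nonneg mult_nonneg_nonneg order.refl) auto
    also have "\<dots> \<le> K * r_Mh1 r + K * ((1 + ?t) * ?N) + K * (r_MH r * ln ?N)"
    proof (intro add_mono)
      have K: "ci \<le> K" "(cs + cb) * D \<le> K" "cc * L \<le> K"
        using ci(1) cs cb cc D L by (auto simp: K_def)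
      show "ci * r_Mh1 r \<le> K * r_Mh1 r" using K(1) Mh1 by (rule mult_right_mono)
      \<comment> \<open>Source solves and matrix building come under the common factor
        \<open>1 + ?t\<close>; the excess \<open>cs * ?t + cb\<close> is nonnegative.\<close>
      have "0 \<le> cs * ?t" using cs t by (intro mult_nonneg_nonneg) auto
      moreover have "(cs + cb) * (1 + s) = cs + cb * s + (cs * s + cb)" for s
        by (simp add: algebra_simps)
      ultimately have "cs + cb * ?t \<le> (cs + cb) * (1 + ?t)" using cb by simp
      then have "(cs + cb * ?t) * (D * ?N) \<le> ((cs + cb) * (1 + ?t)) * (D * ?N)"
        using D N1 by (intro mult_right_mono) auto
      also have "\<dots> = ((cs + cb) * D) * ((1 + ?t) * ?N)" by (simp add: mult_ac)
      also have "\<dots> \<le> K * ((1 + ?t) * ?N)"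
        using K(2) N1 t by (intro mult_right_mono) auto
      finally show "(cs + cb * ?t) * (D * ?N) \<le> K * ((1 + ?t) * ?N)" .
      have "cc * r_MH r * (L * ln ?N) = (cc * L) * (r_MH r * ln ?N)" by (simp add: mult_ac)
      also have "\<dots> \<le> K * (r_MH r * ln ?N)"
        using K(3) MH N1 by (intro mult_right_mono) auto
      finally show "cc * r_MH r * (L * ln ?N) \<le> K * (r_MH r * ln ?N)" .
    qed
    also have "\<dots> = K * ((1 + ?t) * ?N + r_MH r * ln ?N + r_Mh1 r)"
      by (simp add: algebra_simps)
    finally have upper: "total_work r p \<le> K * ((1 + ?t) * ?N + r_MH r * ln ?N + r_Mh1 r)" .
    \<comment> \<open>Both sides are nonnegative, the logarithm because \<open>?N \<ge> 1\<close>,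
      so the upper bound already is the bound between absolute values.\<close>
    have "0 \<le> total_work r p"
      unfolding total_work_def using nonneg by (intro add_nonneg_nonneg sum_nonneg) auto
    moreover have "0 \<le> (1 + ?t) * ?N + r_MH r * ln ?N + r_Mh1 r"
      using MH Mh1 N1 t by (intro add_nonneg_nonneg mult_nonneg_nonneg) auto
    ultimately show ?thesis using upper by simp
  qed
  show ?thesis
    unfolding nodes_def
    by (rule bigoI[where c = K], unfold eventually_principal, intro ballI)
      (use bound in \<open>simp split: prod.splits\<close>)
qed

end
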